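(* Let $(X,\mathcal B_X)$ be a measurable space, and let $T_0,T_1,\ldots$ be an $X$-valued Markov chain on a probability space $(\Omega,\mathcal F,\mathbb P)$ with transition operator $R$ acting on $\mathcal M(X,\mathcal B_X)$. Let $h$ be a positive measurable function on $X$ such that $Rh=h$. Then the process $M_n=h\circ T_n$, $n=0,1,\ldots$, is a martingale with respect to $(T_n)_{n\in\mathbb N_0}$.
   Context: $\mathcal M(X,\mathcal B_X)$ is the space of real-valued measurable functions on $X$. Let $\mathcal F_n=\mathcal F_{T_n}=T_n^{-1}(\mathcal B_X)$, and let $\bigvee_{j=0}^n\mathcal F_j$ be the sigma-algebra generated by $T_0,\ldots,T_n$. That $(T_n)$ is a Markov chain with transition operator $R$ means $$\mathbb E\Big(f\circ T_{n+1}\,\Big|\,\bigvee_{j=0}^n\mathcal F_j\Big)=\mathbb E\left(f\circ T_{n+1}\,|\,\mathcal F_n\right)=(Rf)\circ T_n,\qquad n\in\mathbb N_0,$$ for every $f\in\mathcal M(X,\mathcal B_X)$ for which the conditional expectation is defined ($f\ge0$ or $f\circ T_{n+1}$ integrable). A process $(M_n)_{n\in\mathbb N_0}$ is called a martingale with respect to $(T_n)_{n\in\mathbb N_0}$ if $\mathbb E\big(M_{n+k}\,|\,\bigvee_{j=0}^n\mathcal F_{T_j}\big)=M_n$ for all $n,k\in\mathbb N_0$. *)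

theory Defs
  imports "HOL-Probability.Probability"
begin

text \<open>
  The library's \<^const>\<open>real_cond_exp\<close> maps infinite conditional expectations of nonnegative
  functions to 0.  The following variant keeps the value \<open>\<infinity>\<close>.  It is the conditional
  expectation of a measurable \<open>f\<close> that is nonnegative or integrable; for other \<open>f\<close> it is
  not meaningful.
\<close>

definition ext_cond_exp :: "'w measure \<Rightarrow> 'w measure \<Rightarrow> ('w \<Rightarrow> real) \<Rightarrow> 'w \<Rightarrow> ereal" where
  "ext_cond_exp M F f \<omega> =
     enn2ereal (nn_cond_exp M F (\<lambda>x. ennreal (f x)) \<omega>)
     - enn2ereal (nn_cond_exp M F (\<lambda>x. ennreal (- f x)) \<omega>)"

lemma (in sigma_finite_subalgebra) ext_cond_exp_nonneg:
  assumes [measurable]: "f \<in> borel_measurable M" and nonneg: "\<And>\<omega>. \<omega> \<in> space M \<Longrightarrow> 0 \<le> f \<omega>"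
  shows "AE \<omega> in M. ext_cond_exp M F f \<omega> = enn2ereal (nn_cond_exp M F (\<lambda>x. ennreal (f x)) \<omega>)"
proof -
  have "AE \<omega> in M. nn_cond_exp M F (\<lambda>x. ennreal (- f x)) \<omega> = nn_cond_exp M F (\<lambda>_. 0) \<omega>"
    by (rule nn_cond_exp_cong) (auto intro!: AE_I2 simp: ennreal_neg nonneg)
  moreover have "AE \<omega> in M. 0 = nn_cond_exp M F (\<lambda>_. 0) \<omega>"
    by (rule nn_cond_exp_F_meas) auto
  ultimately show ?thesis
    by eventually_elim (simp add: ext_cond_exp_def zero_ennreal.rep_eq)
qed

lemma (in sigma_finite_subalgebra) ext_cond_exp_integrable:
  assumes "integrable M f"
  shows "AE \<omega> in M. ext_cond_exp M F f \<omega> = ereal (real_cond_exp M F f \<omega>)"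
proof -
  have fin: "AE \<omega> in M. nn_cond_exp M F (\<lambda>x. ennreal (g x)) \<omega> \<noteq> \<infinity>"
    if g: "integrable M g" for g :: "'a \<Rightarrow> real"
  proof (rule nn_integral_PInf_AE)
    have [measurable]: "g \<in> borel_measurable M" using g by auto
    show "nn_cond_exp M F (\<lambda>x. ennreal (g x)) \<in> borel_measurable M"
      by (rule borel_measurable_nn_cond_exp2)
    have "(\<integral>\<^sup>+ \<omega>. nn_cond_exp M F (\<lambda>x. ennreal (g x)) \<omega> \<partial>M) = (\<integral>\<^sup>+ \<omega>. ennreal (g \<omega>) \<partial>M)"
      using nn_cond_exp_intg[of "\<lambda>_. 1" "\<lambda>x. ennreal (g x)"] by simp
    also have "\<dots> \<noteq> \<infinity>"
      using g by (simp add: real_integrable_def)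
    finally show "(\<integral>\<^sup>+ \<omega>. nn_cond_exp M F (\<lambda>x. ennreal (g x)) \<omega> \<partial>M) \<noteq> \<infinity>" .
  qed
  have "integrable M (\<lambda>x. - f x)" using assms by simp
  from fin[OF assms] fin[OF this] show ?thesis
  proof eventually_elim
    case (elim \<omega>)
    have *: "enn2ereal a = ereal (enn2real a)" if "a \<noteq> \<infinity>" for a :: ennreal
      using that by (cases a) auto
    show ?case
      using elim by (simp add: ext_cond_exp_def real_cond_exp_def *)
  qed
qed

definition past_algebra :: "'w measure \<Rightarrow> 'a measure \<Rightarrow> (nat \<Rightarrow> 'w \<Rightarrow> 'a) \<Rightarrow> nat \<Rightarrow> 'w measure" where
  "past_algebra M X T n = sigma (space M) (\<Union>j\<le>n. sets (vimage_algebra (space M) (T j) X))"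

text \<open>
  For nonnegative \<open>f\<close> the conditional expectation of \<open>f \<circ> T\<^sub>n\<^sub>+\<^sub>1\<close> may be infinite, so \<open>R f\<close> is
  allowed to take extended real values.  An operator with real values is the special case
  in which all these values are finite.
\<close>

definition markov_chain ::
  "'w measure \<Rightarrow> 'a measure \<Rightarrow> (nat \<Rightarrow> 'w \<Rightarrow> 'a) \<Rightarrow> (('a \<Rightarrow> real) \<Rightarrow> 'a \<Rightarrow> ereal) \<Rightarrow> bool" where
  "markov_chain M X T R \<longleftrightarrow>
     (\<forall>n. T n \<in> measurable M X) \<and>
     (\<forall>f \<in> borel_measurable X. R f \<in> borel_measurable X) \<and>
     (\<forall>n. \<forall>f \<in> borel_measurable X.
        (\<forall>x\<in>space X. 0 \<le> f x) \<or> integrable M (f \<circ> T (Suc n)) \<longrightarrow>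
        (AE \<omega> in M.
           ext_cond_exp M (past_algebra M X T n) (f \<circ> T (Suc n)) \<omega>
           = ext_cond_exp M (vimage_algebra (space M) (T n) X) (f \<circ> T (Suc n)) \<omega>) \<and>
        (AE \<omega> in M.
           ext_cond_exp M (vimage_algebra (space M) (T n) X) (f \<circ> T (Suc n)) \<omega>
           = R f (T n \<omega>)))"

text \<open>
  Integrability is not part of this notion of martingale: as for Markov chains, the
  conditional expectations only have to be defined, so each \<open>Y\<^sub>n\<close> is nonnegative or integrable.
\<close>

definition martingale_wrt ::
  "'w measure \<Rightarrow> 'a measure \<Rightarrow> (nat \<Rightarrow> 'w \<Rightarrow> 'a) \<Rightarrow> (nat \<Rightarrow> 'w \<Rightarrow> real) \<Rightarrow> bool" where
  "martingale_wrt M X T Y \<longleftrightarrow>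
     (\<forall>n. Y n \<in> borel_measurable M \<and>
          ((\<forall>\<omega>\<in>space M. 0 \<le> Y n \<omega>) \<or> integrable M (Y n))) \<and>
     (\<forall>n k. AE \<omega> in M. ext_cond_exp M (past_algebra M X T n) (Y (n + k)) \<omega> = ereal (Y n \<omega>))"

end

theory Submission imports Defs begin

text \<open>
  For a nonnegative harmonic function \<open>h\<close> the Markov property says that conditioning \<open>h \<circ> T\<^sub>m\<^sub>+\<^sub>1\<close>
  on the past up to time \<open>m\<close> gives \<open>R h \<circ> T\<^sub>m = h \<circ> T\<^sub>m\<close>; this is the martingale property for a
  single step, \<open>nn_cond_exp_harmonic_Suc\<close>.  Longer steps follow from the tower property, since the past up to time \<open>n\<close> is
  contained in the past up to every later time \<open>n + k\<close>.

  Since \<open>h \<circ> T\<^sub>n\<close> need not be integrable, the induction over the step length is carried out with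
  conditional expectations of functions with values in \<open>[0, \<infinity>]\<close>, for which the tower property
  needs no integrability; \<open>nn_cond_exp_harmonic\<close> is the martingale property in this form.
\<close>

lemma space_past_algebra [simp]: "space (past_algebra M X T n) = space M"
  by (simp add: past_algebra_def space_measure_of_conv)

lemma sets_past_algebra:
  "sets (past_algebra M X T n) =
     sigma_sets (space M) (\<Union>j\<le>n. sets (vimage_algebra (space M) (T j) X))"
  unfolding past_algebra_def
  by (rule sets_measure_of) (use sets.sets_into_space in fastforce)

lemma subalgebra_past_algebra:
  assumes "\<And>j. T j \<in> measurable M X"
  shows "subalgebra M (past_algebra M X T n)"
proof -
  have "sets (vimage_algebra (space M) (T j) X) \<subseteq> sets M" for j
    using assms[of j] by (simp add: sets_image_in_sets)
  then show ?thesis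
    unfolding subalgebra_def sets_past_algebra by (auto intro!: sets.sigma_sets_subset)
qed

lemma subalgebra_past_algebra_mono:
  assumes "m \<le> n"
  shows "subalgebra (past_algebra M X T n) (past_algebra M X T m)"
proof -
  have "(\<Union>j\<le>m. sets (vimage_algebra (space M) (T j) X))
      \<subseteq> (\<Union>j\<le>n. sets (vimage_algebra (space M) (T j) X))"
    using assms by force
  then show ?thesis
    unfolding subalgebra_def sets_past_algebra by (simp add: sigma_sets_mono')
qed

lemma measurable_past_algebra:
  assumes "T n \<in> measurable M X"
  shows "T n \<in> measurable (past_algebra M X T n) X"
proof (rule measurableI)
  show "T n \<omega> \<in> space X" if "\<omega> \<in> space (past_algebra M X T n)" for \<omega>
    using that assms by (auto dest: measurable_space)
  show "T n -` A \<inter> space (past_algebra M X T n) \<in> sets (past_algebra M X T n)" if "A \<in> sets X" for A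
    using that by (auto simp: sets_past_algebra intro!: sigma_sets.Basic in_vimage_algebra)
qed

lemma (in prob_space) sigma_finite_subalgebra_past_algebra:
  assumes "\<And>j. T j \<in> measurable M X"
  shows "sigma_finite_subalgebra M (past_algebra M X T n)"
  using subalgebra_past_algebra[OF assms] finite_measure_axioms
  by (intro finite_measure_subalgebra_is_sigma_finite)
     (simp add: finite_measure_subalgebra_def finite_measure_subalgebra_axioms_def)

text \<open>
  The Markov property equates extended real conditional expectations.  As \<open>h\<close> is nonnegative, the
  negative part contributes nothing, so the equation descends to \<open>[0, \<infinity>]\<close>.
\<close>

lemma (in prob_space) nn_cond_exp_harmonic_Suc:
  assumes chain: "markov_chain M X T R"
    and h: "h \<in> borel_measurable X" and nonneg: "\<forall>x\<in>space X. 0 \<le> h x"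
    and harmonic: "\<forall>x\<in>space X. R h x = ereal (h x)"
  shows "AE \<omega> in M. nn_cond_exp M (past_algebra M X T n) (\<lambda>\<omega>. ennreal (h (T (Suc n) \<omega>))) \<omega>
    = ennreal (h (T n \<omega>))"
proof -
  have T [measurable]: "T j \<in> measurable M X" for j
    using chain by (simp add: markov_chain_def)
  note h [measurable]
  interpret F: sigma_finite_subalgebra M "past_algebra M X T n"
    by (rule sigma_finite_subalgebra_past_algebra[OF T])
  have TX: "T j \<omega> \<in> space X" if "\<omega> \<in> space M" for j \<omega>
    using T that by (rule measurable_space)
  have "AE \<omega> in M. ext_cond_exp M (past_algebra M X T n) (h \<circ> T (Suc n)) \<omega>
      = ext_cond_exp M (vimage_algebra (space M) (T n) X) (h \<circ> T (Suc n)) \<omega>"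
    "AE \<omega> in M. ext_cond_exp M (vimage_algebra (space M) (T n) X) (h \<circ> T (Suc n)) \<omega>
      = R h (T n \<omega>)"
    using chain h nonneg unfolding markov_chain_def by blast+
  moreover have "AE \<omega> in M. ext_cond_exp M (past_algebra M X T n) (h \<circ> T (Suc n)) \<omega>
      = enn2ereal (nn_cond_exp M (past_algebra M X T n) (\<lambda>\<omega>. ennreal ((h \<circ> T (Suc n)) \<omega>)) \<omega>)"
    by (rule F.ext_cond_exp_nonneg) (auto simp: nonneg TX)
  ultimately show ?thesis
    using AE_space
  proof eventually_elim
    case (elim \<omega>)
    then have "enn2ereal (nn_cond_exp M (past_algebra M X T n) (\<lambda>\<omega>. ennreal (h (T (Suc n) \<omega>))) \<omega>)
        = enn2ereal (ennreal (h (T n \<omega>)))"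
      using nonneg harmonic TX by (simp add: enn2ereal_ennreal)
    then show ?case
      by (simp add: enn2ereal_inject)
  qed
qed

text \<open>
  The induction peels off the last step: conditioning \<open>h \<circ> T\<^sub>n\<^sub>+\<^sub>k\<^sub>+\<^sub>1\<close> first on the past up to time
  \<open>n + k\<close> turns it into \<open>h \<circ> T\<^sub>n\<^sub>+\<^sub>k\<close>, to which the induction hypothesis applies.
\<close>

lemma (in prob_space) nn_cond_exp_harmonic:
  assumes chain: "markov_chain M X T R"
    and h: "h \<in> borel_measurable X" and nonneg: "\<forall>x\<in>space X. 0 \<le> h x"
    and harmonic: "\<forall>x\<in>space X. R h x = ereal (h x)"
  shows "AE \<omega> in M. nn_cond_exp M (past_algebra M X T n) (\<lambda>\<omega>. ennreal (h (T (n + k) \<omega>))) \<omega>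
    = ennreal (h (T n \<omega>))"
proof -
  have T [measurable]: "T j \<in> measurable M X" for j
    using chain by (simp add: markov_chain_def)
  note h [measurable]
  interpret F: sigma_finite_subalgebra M "past_algebra M X T n"
    by (rule sigma_finite_subalgebra_past_algebra[OF T])
  show ?thesis
  proof (induction k)
    case 0
    have [measurable]: "T n \<in> measurable (past_algebra M X T n) X"
      by (rule measurable_past_algebra[OF T])
    have "AE \<omega> in M. ennreal (h (T n \<omega>))
        = nn_cond_exp M (past_algebra M X T n) (\<lambda>\<omega>. ennreal (h (T n \<omega>))) \<omega>"
      by (rule F.nn_cond_exp_F_meas) measurable
    then show ?case by eventually_elim simp
  next
    case (Suc k)
    let ?Y = "\<lambda>j \<omega>. ennreal (h (T j \<omega>))"
    have "AE \<omega> in M. nn_cond_exp M (past_algebra M X T n) (?Y (n + Suc k)) \<omega>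
        = nn_cond_exp M (past_algebra M X T n)
            (nn_cond_exp M (past_algebra M X T (n + k)) (?Y (n + Suc k))) \<omega>"
      by (rule F.nn_cond_exp_nested_subalg)
         (auto intro: subalgebra_past_algebra subalgebra_past_algebra_mono)
    moreover have "AE \<omega> in M. nn_cond_exp M (past_algebra M X T n)
            (nn_cond_exp M (past_algebra M X T (n + k)) (?Y (n + Suc k))) \<omega>
        = nn_cond_exp M (past_algebra M X T n) (?Y (n + k)) \<omega>"
      using nn_cond_exp_harmonic_Suc[OF assms, of "n + k"]
      by (intro F.nn_cond_exp_cong) (auto intro: borel_measurable_nn_cond_exp2)
    ultimately show ?case
      using Suc.IH by eventually_elim simp
  qed
qed

theorem proposition2p24:
  fixes M :: "'w measure" and X :: "'a measure"
    and T :: "nat \<Rightarrow> 'w \<Rightarrow> 'a" and R :: "('a \<Rightarrow> real) \<Rightarrow> 'a \<Rightarrow> ereal" and h :: "'a \<Rightarrow> real"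
  assumes "prob_space M"
    and "markov_chain M X T R"
    and "h \<in> borel_measurable X"
    and "\<forall>x\<in>space X. 0 \<le> h x"
    and "\<forall>x\<in>space X. R h x = ereal (h x)"
  shows "martingale_wrt M X T (\<lambda>n. h \<circ> T n)"
proof -
  interpret prob_space M by fact
  have T [measurable]: "T j \<in> measurable M X" for j
    using assms(2) by (simp add: markov_chain_def)
  note assms(3) [measurable]
  have nonneg: "0 \<le> h (T j \<omega>)" if "\<omega> \<in> space M" for j \<omega>
    using assms(4) measurable_space[OF T that] by blast
  have "AE \<omega> in M. ext_cond_exp M (past_algebra M X T n) (h \<circ> T (n + k)) \<omega> = ereal ((h \<circ> T n) \<omega>)"
    for n k
  proof -
    interpret F: sigma_finite_subalgebra M "past_algebra M X T n"
      by (rule sigma_finite_subalgebra_past_algebra[OF T])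
    have "AE \<omega> in M. ext_cond_exp M (past_algebra M X T n) (h \<circ> T (n + k)) \<omega>
        = enn2ereal (nn_cond_exp M (past_algebra M X T n) (\<lambda>\<omega>. ennreal ((h \<circ> T (n + k)) \<omega>)) \<omega>)"
      by (rule F.ext_cond_exp_nonneg) (auto simp: nonneg)
    then show ?thesis
      using nn_cond_exp_harmonic[OF assms(2-5), of n k] AE_space
      by eventually_elim (simp add: enn2ereal_ennreal nonneg)
  qed
  then show ?thesis
    unfolding martingale_wrt_def by (auto simp: nonneg)
qed

end
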